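(* Let $\Delta$ be a balanced facet complex. Then $\Delta$ is odd-cycle-free and the line graph $L(\Delta)$ does not contain the complement of a 7-cycle as an induced subgraph.
   Context: A facet complex over a finite vertex set $V$ is a set $\Delta$ of subsets of $V$ such that $F,G\in\Delta$ and $F\subseteq G$ imply $F=G$; its elements are called facets (edges). Any subset of $\Delta$ is again a facet complex. A facet $F$ of a facet complex $\Delta$ is a leaf of $\Delta$ if either $F$ is the only facet of $\Delta$, or there exists $G\in\Delta\setminus\{F\}$ such that $H\cap F\subseteq G$ for all $H\in\Delta\setminus\{F\}$. A nonempty facet complex is a (simplicial) cycle if it has no leaf but every nonempty proper subset of it has a leaf; its length is its number of facets. A facet complex $\Delta$ is odd-cycle-free if no subset of $\Delta$ is a cycle of odd length. A hyper-cycle of length $\ell\ge 2$ in $\Delta$ is a sequence $(x_1,F_1,x_2,F_2,\dots,x_\ell,F_\ell,x_1)$ where the $x_i$ are distinct vertices, the $F_i$ are distinct facets of $\Delta$, and $x_i,x_{i+1}\in F_i$ for all $i$ (indices mod $\ell$). $\Delta$ is balanced if every hyper-cycle of odd length has an edge $F_i$ (one of the facets of the hyper-cycle) containing at least three of the vertices $x_1,\dots,x_\ell$ of the hyper-cycle. The line graph $L(\Delta)$ of $\Delta=\{F_1,\dots,F_m\}$ is the graph with vertices $e_1,\dots,e_m$ (representing the facets), where for $i\ne j$ the vertices $e_i,e_j$ are joined by an edge iff $F_i\cap F_j\neq\emptyset$. The complement of a 7-cycle is the complement of the graph $C_7$ (the graph cycle on 7 vertices). *)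

theory Defs
  imports "Graph_Theory.Graph_Theory"
begin

definition facet_complex :: "'a set \<Rightarrow> 'a set set \<Rightarrow> bool" where
  "facet_complex V \<Delta> \<longleftrightarrow>
     finite V \<and> (\<forall>F\<in>\<Delta>. F \<subseteq> V) \<and> (\<forall>F\<in>\<Delta>. \<forall>G\<in>\<Delta>. F \<subseteq> G \<longrightarrow> F = G)"

definition is_leaf :: "'a set set \<Rightarrow> 'a set \<Rightarrow> bool" where
  "is_leaf \<Delta> F \<longleftrightarrow>
     F \<in> \<Delta> \<and> (\<Delta> = {F} \<or> (\<exists>G\<in>\<Delta> - {F}. \<forall>H\<in>\<Delta> - {F}. H \<inter> F \<subseteq> G))"

definition simplicial_cycle :: "'a set set \<Rightarrow> bool" where
  "simplicial_cycle \<Delta> \<longleftrightarrow>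
     \<Delta> \<noteq> {} \<and> \<not> (\<exists>F. is_leaf \<Delta> F) \<and>
     (\<forall>\<Gamma>. \<Gamma> \<subset> \<Delta> \<and> \<Gamma> \<noteq> {} \<longrightarrow> (\<exists>F. is_leaf \<Gamma> F))"

definition odd_cycle_free :: "'a set set \<Rightarrow> bool" where
  "odd_cycle_free \<Delta> \<longleftrightarrow> \<not> (\<exists>\<Gamma>\<subseteq>\<Delta>. simplicial_cycle \<Gamma> \<and> odd (card \<Gamma>))"

text \<open>
  The hyper-cycle \<open>(x\<^sub>1, F\<^sub>1, \<dots>, x\<^sub>l, F\<^sub>l, x\<^sub>1)\<close> is given by the list \<open>xs\<close> of
  its vertices and the list \<open>Fs\<close> of its facets, both of length \<open>l\<close> and indexed
  from 0.
\<close>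

definition hyper_cycle :: "'a set set \<Rightarrow> 'a list \<Rightarrow> 'a set list \<Rightarrow> bool" where
  "hyper_cycle \<Delta> xs Fs \<longleftrightarrow>
     length xs = length Fs \<and> 2 \<le> length Fs \<and>
     distinct xs \<and> distinct Fs \<and> set Fs \<subseteq> \<Delta> \<and>
     (\<forall>i<length Fs. xs ! i \<in> Fs ! i \<and> xs ! (Suc i mod length Fs) \<in> Fs ! i)"

definition balanced :: "'a set set \<Rightarrow> bool" where
  "balanced \<Delta> \<longleftrightarrow>
     (\<forall>xs Fs. hyper_cycle \<Delta> xs Fs \<and> odd (length Fs) \<longrightarrow>
        (\<exists>F\<in>set Fs. 3 \<le> card (F \<inter> set xs)))"

text \<open>
  Undirected simple graphs are encoded as in \<^locale>\<open>pair_graph\<close>: an undirected edge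
  is a pair of opposite arcs, and there are no loops.
\<close>

definition line_graph :: "'a set set \<Rightarrow> 'a set pair_pre_digraph" where
  "line_graph \<Delta> =
     \<lparr>pverts = \<Delta>, parcs = {(F, G). F \<in> \<Delta> \<and> G \<in> \<Delta> \<and> F \<noteq> G \<and> F \<inter> G \<noteq> {}}\<rparr>"

definition graph_complement :: "'v pair_pre_digraph \<Rightarrow> 'v pair_pre_digraph" where
  "graph_complement G =
     \<lparr>pverts = pverts G,
      parcs = {(u, v). u \<in> pverts G \<and> v \<in> pverts G \<and> u \<noteq> v \<and> (u, v) \<notin> parcs G}\<rparr>"

text \<open>The cycle \<open>C\<^sub>n\<close> on the vertices \<open>0, \<dots>, n - 1\<close>, meant for \<open>n \<ge> 3\<close>.\<close>

definition cycle_graph :: "nat \<Rightarrow> nat pair_pre_digraph" where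
  "cycle_graph n =
     \<lparr>pverts = {..<n},
      parcs = {(u, v). u < n \<and> v < n \<and> (v = Suc u mod n \<or> u = Suc v mod n)}\<rparr>"

definition has_induced_copy ::
  "'u pair_pre_digraph \<Rightarrow> 'v pair_pre_digraph \<Rightarrow> bool" where
  "has_induced_copy G K \<longleftrightarrow>
     (\<exists>H :: 'u pair_pre_digraph.
        induced_subgraph (with_proj H) (with_proj G) \<and>
        digraph_iso (with_proj H) (with_proj K))"

lemma pair_graph_line_graph:
  assumes "facet_complex V \<Delta>"
  shows "pair_graph (line_graph \<Delta>)"
proof -
  have fin: "finite \<Delta>"
    using assms finite_subset[of \<Delta> "Pow V"] by (auto simp: facet_complex_def)
  show ?thesis
  proof
    show "finite (parcs (line_graph \<Delta>))"
      by (rule finite_subset[of _ "\<Delta> \<times> \<Delta>"]) (auto simp: line_graph_def fin)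
    show "symmetric (with_proj (line_graph \<Delta>))"
      by (auto simp: symmetric_def sym_def line_graph_def)
  qed (auto simp: line_graph_def fin)
qed

lemma pair_graph_cycle_graph:
  assumes "2 \<le> n"
  shows "pair_graph (cycle_graph n)"
proof
  show "finite (parcs (cycle_graph n))"
    by (rule finite_subset[of _ "{..<n} \<times> {..<n}"]) (auto simp: cycle_graph_def)
  show "symmetric (with_proj (cycle_graph n))"
    by (auto simp: symmetric_def sym_def cycle_graph_def)
qed (use assms in \<open>auto simp: cycle_graph_def mod_Suc split: if_splits\<close>)

lemma pair_graph_graph_complement:
  assumes "pair_graph G"
  shows "pair_graph (graph_complement G)"
proof -
  interpret pair_graph G by fact
  show ?thesis
  proof
    show "finite (parcs (graph_complement G))"
      by (rule finite_subset[of _ "pverts G \<times> pverts G"]) (auto simp: graph_complement_def)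
    show "symmetric (with_proj (graph_complement G))"
      using arcs_symmetric by (auto simp: symmetric_def sym_def graph_complement_def)
  qed (auto simp: graph_complement_def)
qed

end

theory Submission
  imports Defs
begin

text \<open>
  Call two facets strong neighbors if no third facet contains their intersection. In a simplicial
  cycle every facet has two strong neighbors, since a leaf that appears when a facet is removed is
  a strong neighbor of that facet. A longest path of strong neighbors therefore closes up to a
  ring; rings are leafless, so by minimality the ring is the whole cycle. Minimality also gives
  for every two consecutive facets a vertex that lies in no other facet. These vertices form a
  hyper-cycle whose facets contain only two of them each, so its length cannot be odd.

  For the complement of the 7-cycle, balancedness of 3-cycles makes any three pairwise
  intersecting facets have a common vertex. In the cyclic order \<open>G\<^sub>k = F\<^sub>2\<^sub>k\<close> this provides vertices
  \<open>y\<^sub>k\<close> that lie exactly in \<open>G\<^sub>k, G\<^sub>k\<^sub>+\<^sub>1, G\<^sub>k\<^sub>+\<^sub>2\<close>, and \<open>y\<^sub>0, G\<^sub>2, y\<^sub>2, G\<^sub>3, y\<^sub>3, G\<^sub>5, y\<^sub>4, G\<^sub>6, y\<^sub>6, G\<^sub>0\<close> is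
  a hyper-cycle of length 5 violating balancedness.
\<close>

section \<open>Strong neighbors and rings of facets\<close>

definition strong_neighbors :: "'a set set \<Rightarrow> 'a set \<Rightarrow> 'a set \<Rightarrow> bool" where
  "strong_neighbors \<Delta> F G \<longleftrightarrow>
     F \<in> \<Delta> \<and> G \<in> \<Delta> \<and> F \<noteq> G \<and> (\<forall>H\<in>\<Delta> - {F, G}. \<not> F \<inter> G \<subseteq> H)"

lemma strong_neighbors_sym: "strong_neighbors \<Delta> F G \<Longrightarrow> strong_neighbors \<Delta> G F"
  unfolding strong_neighbors_def by (auto simp: Int_commute)

lemma strong_neighbors_subset:
  assumes "strong_neighbors \<Delta> F G" "\<Gamma> \<subseteq> \<Delta>" "F \<in> \<Gamma>" "G \<in> \<Gamma>"
  shows "strong_neighbors \<Gamma> F G"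
  using assms unfolding strong_neighbors_def by blast

lemma is_leafE:
  assumes "is_leaf \<Delta> F" "\<Delta> \<noteq> {F}"
  obtains G where "G \<in> \<Delta> - {F}" "\<forall>H\<in>\<Delta> - {F}. H \<inter> F \<subseteq> G"
  using assms unfolding is_leaf_def by metis

text \<open>If \<open>F\<close> is a leaf with joint \<open>G\<close>, then \<open>G\<close>
  contains \<open>F \<inter> R\<close> for every strong neighbor \<open>R\<close> of
  \<open>F\<close>, which forces \<open>G = R\<close>. So a leaf has at most one strong
  neighbor.\<close>

lemma not_is_leaf_if_two_strong_neighbors:
  assumes "strong_neighbors \<Delta> F P" "strong_neighbors \<Delta> F Q" "P \<noteq> Q"
  shows "\<not> is_leaf \<Delta> F"
proof
  assume "is_leaf \<Delta> F"
  moreover have "\<Delta> \<noteq> {F}"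
    using assms(1) by (auto simp: strong_neighbors_def)
  ultimately obtain G where G: "G \<in> \<Delta> - {F}" "\<forall>H\<in>\<Delta> - {F}. H \<inter> F \<subseteq> G"
    by (rule is_leafE) blast
  have "G = R" if "strong_neighbors \<Delta> F R" for R
  proof (rule ccontr)
    assume "G \<noteq> R"
    then have "\<not> F \<inter> R \<subseteq> G"
      using that G(1) unfolding strong_neighbors_def by blast
    moreover have "R \<inter> F \<subseteq> G"
      using that G(2) unfolding strong_neighbors_def by blast
    ultimately show False
      by blast
  qed
  with assms show False
    by metis
qed

text \<open>The ambient complex is a separate parameter because a ring is first found inside a large
  complex and then viewed in the complex of its own facets.\<close>

definition strong_ring :: "'a set set \<Rightarrow> 'a set list \<Rightarrow> bool" where
  "strong_ring \<Delta> fs \<longleftrightarrow>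
     distinct fs \<and> 3 \<le> length fs \<and>
     (\<forall>i<length fs. strong_neighbors \<Delta> (fs ! i) (fs ! (Suc i mod length fs)))"

lemma mod_Suc_pred:
  fixes i n :: nat
  assumes "i < n"
  shows "Suc ((i + n - 1) mod n) mod n = i"
  using assms by (simp add: mod_Suc_eq)

lemma strong_ring_no_leaf:
  assumes "strong_ring (set fs) fs"
  shows "\<not> is_leaf (set fs) F"
proof
  assume leaf: "is_leaf (set fs) F"
  let ?n = "length fs"
  obtain i where i: "i < ?n" "F = fs ! i"
    using leaf by (auto simp: is_leaf_def in_set_conv_nth)
  let ?p = "(i + ?n - 1) mod ?n" and ?q = "Suc i mod ?n"
  have len: "3 \<le> ?n" and dist: "distinct fs"
    and strong: "\<And>j. j < ?n \<Longrightarrow> strong_neighbors (set fs) (fs ! j) (fs ! (Suc j mod ?n))"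
    using assms by (auto simp: strong_ring_def)
  have lt: "?p < ?n" "?q < ?n"
    using len by (auto intro: mod_less_divisor)
  \<comment> \<open>If predecessor and successor coincided, two steps around the ring would return
    to \<open>i\<close>, which length at least 3 excludes.\<close>
  have "?p \<noteq> ?q"
  proof
    assume "?p = ?q"
    then have "Suc ?q mod ?n = i"
      using mod_Suc_pred[OF i(1)] by simp
    then show False
      using i(1) len by (auto simp: mod_Suc split: if_splits)
  qed
  then have "fs ! ?p \<noteq> fs ! ?q"
    using lt dist by (simp add: nth_eq_iff_index_eq)
  moreover have "strong_neighbors (set fs) F (fs ! ?q)"
    using strong i by simp
  moreover have "strong_neighbors (set fs) F (fs ! ?p)"
    using strong[OF lt(1)] i mod_Suc_pred[OF i(1)] by (simp add: strong_neighbors_sym)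
  ultimately show False
    using not_is_leaf_if_two_strong_neighbors leaf by metis
qed

text \<open>Lets a statement about the closing pair of a ring be applied to every consecutive
  pair.\<close>

lemma strong_ring_rotate:
  assumes "strong_ring \<Delta> fs"
  shows "strong_ring \<Delta> (rotate k fs)"
proof -
  have ne: "0 < length fs"
    using assms by (auto simp: strong_ring_def)
  have "strong_neighbors \<Delta> (rotate k fs ! i) (rotate k fs ! (Suc i mod length fs))"
    if "i < length fs" for i
  proof -
    have "strong_neighbors \<Delta> (fs ! ((k + i) mod length fs))
            (fs ! (Suc ((k + i) mod length fs) mod length fs))"
      using assms ne by (auto simp: strong_ring_def)
    moreover have "Suc ((k + i) mod length fs) mod length fs
        = (k + Suc i mod length fs) mod length fs"
      by (simp add: mod_Suc_eq mod_add_right_eq)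
    ultimately show ?thesis
      using that ne by (simp add: nth_rotate)
  qed
  then show ?thesis
    using assms by (simp add: strong_ring_def)
qed

section \<open>Leaves of forests and strong rings in simplicial cycles\<close>

text \<open>Induction on the number of facets. Removing a leaf \<open>F\<close> with joint
  \<open>G\<close> leaves a forest with two leaves, one of which, \<open>L\<close>, differs from
  \<open>G\<close>. If \<open>K\<close> is a joint of \<open>L\<close>, then
  \<open>F \<inter> L \<subseteq> G \<inter> L \<subseteq> K\<close>, so \<open>L\<close> and
  \<open>F\<close> are both leaves of the whole.\<close>

lemma two_leaves_if_forest:
  assumes "finite \<Delta>" "2 \<le> card \<Delta>" "\<forall>\<Gamma>\<subseteq>\<Delta>. \<Gamma> \<noteq> {} \<longrightarrow> (\<exists>F. is_leaf \<Gamma> F)"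
  shows "\<exists>F G. F \<noteq> G \<and> is_leaf \<Delta> F \<and> is_leaf \<Delta> G"
  using assms
proof (induction "card \<Delta>" arbitrary: \<Delta> rule: less_induct)
  case less
  show ?case
  proof (cases "card \<Delta> = 2")
    case True
    then obtain F G where "\<Delta> = {F, G}" "F \<noteq> G"
      by (auto simp: card_2_iff)
    then have "is_leaf \<Delta> F" "is_leaf \<Delta> G"
      by (auto simp: is_leaf_def)
    with \<open>F \<noteq> G\<close> show ?thesis
      by blast
  next
    case False
    with less.prems have card: "3 \<le> card \<Delta>"
      by simp
    then have "\<Delta> \<noteq> {}"
      by auto
    then obtain F where F: "is_leaf \<Delta> F"
      using less.prems(3)[rule_format, of \<Delta>] by auto
    moreover have "\<Delta> \<noteq> {F}"
      using card by auto
    ultimately obtain G where G: "G \<in> \<Delta> - {F}" "\<forall>H\<in>\<Delta> - {F}. H \<inter> F \<subseteq> G"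
      by (rule is_leafE) blast
    have FD: "F \<in> \<Delta>"
      using F by (simp add: is_leaf_def)
    have c: "card (\<Delta> - {F}) = card \<Delta> - 1"
      using FD by simp
    have "\<exists>A B. A \<noteq> B \<and> is_leaf (\<Delta> - {F}) A \<and> is_leaf (\<Delta> - {F}) B"
    proof (rule less.hyps)
      show "card (\<Delta> - {F}) < card \<Delta>" "finite (\<Delta> - {F})" "2 \<le> card (\<Delta> - {F})"
        using less.prems card c by auto
      show "\<forall>\<Gamma>\<subseteq>\<Delta> - {F}. \<Gamma> \<noteq> {} \<longrightarrow> (\<exists>F. is_leaf \<Gamma> F)"
        using less.prems(3) by (simp add: subset_Diff_insert)
    qed
    then obtain L where L: "is_leaf (\<Delta> - {F}) L" "L \<noteq> G"
      by metis
    have "\<Delta> - {F} \<noteq> {L}"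
      using G(1) L(2) by blast
    with L(1) obtain K where K: "K \<in> \<Delta> - {F} - {L}"
      "\<forall>H\<in>\<Delta> - {F} - {L}. H \<inter> L \<subseteq> K"
      by (rule is_leafE) blast
    have LD: "L \<in> \<Delta> - {F}"
      using L by (simp add: is_leaf_def)
    \<comment> \<open>The joint of the leaf F is not L, so putting F back does not destroy L as a leaf.\<close>
    have "F \<inter> L \<subseteq> K"
      using bspec[OF G(2) LD] bspec[OF K(2), of G] G(1) L(2) by blast
    then have "\<forall>H\<in>\<Delta> - {L}. H \<inter> L \<subseteq> K"
      using K(2) by blast
    then have "is_leaf \<Delta> L"
      using K(1) LD unfolding is_leaf_def by blast
    with F LD show ?thesis
      by blast
  qed
qed

text \<open>Let \<open>K\<close> be a joint of \<open>G\<close> after the removal of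
  \<open>F\<close>. A third facet \<open>H\<close> containing \<open>F \<inter> G\<close> would give
  \<open>F \<inter> G \<subseteq> H \<inter> G \<subseteq> K\<close>, and \<open>G\<close> would
  have been a leaf from the start.\<close>

lemma strong_neighbors_if_new_leaf:
  assumes "is_leaf (\<Delta> - {F}) G" "F \<in> \<Delta>" "\<not> is_leaf \<Delta> G"
  shows "strong_neighbors \<Delta> F G"
proof -
  have G: "G \<in> \<Delta>" "G \<noteq> F"
    using assms(1) by (auto simp: is_leaf_def)
  have "\<not> F \<inter> G \<subseteq> H" if H: "H \<in> \<Delta> - {F, G}" for H
  proof
    assume FG: "F \<inter> G \<subseteq> H"
    have "\<Delta> - {F} \<noteq> {G}"
      using H by blast
    with assms(1) obtain K where K: "K \<in> \<Delta> - {F} - {G}"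
      "\<forall>H\<in>\<Delta> - {F} - {G}. H \<inter> G \<subseteq> K"
      by (rule is_leafE) blast
    have "H \<inter> G \<subseteq> K"
      using K(2) H by blast
    with FG have "F \<inter> G \<subseteq> K"
      by blast
    then have "\<forall>H\<in>\<Delta> - {G}. H \<inter> G \<subseteq> K"
      using K(2) by blast
    with K(1) G have "is_leaf \<Delta> G"
      unfolding is_leaf_def by blast
    with assms(3) show False ..
  qed
  with G assms(2) show ?thesis
    by (auto simp: strong_neighbors_def)
qed

lemma simplicial_cycle_subset_eq:
  assumes "simplicial_cycle \<Delta>" "\<Gamma> \<subseteq> \<Delta>" "\<Gamma> \<noteq> {}" "\<And>F. \<not> is_leaf \<Gamma> F"
  shows "\<Gamma> = \<Delta>"
  using assms unfolding simplicial_cycle_def by blast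

text \<open>Removing \<open>F\<close> leaves a forest, by minimality of the cycle, and at least two
  facets, since one or two facets alone always have a leaf. The two leaves of this forest are new,
  hence strong neighbors of \<open>F\<close>.\<close>

lemma simplicial_cycle_two_strong_neighbors:
  assumes cyc: "simplicial_cycle \<Delta>" and fin: "finite \<Delta>" and F: "F \<in> \<Delta>"
  shows "\<exists>G H. G \<noteq> H \<and> strong_neighbors \<Delta> F G \<and> strong_neighbors \<Delta> F H"
proof -
  have no_leaf: "\<not> is_leaf \<Delta> A" for A
    using cyc by (simp add: simplicial_cycle_def)
  have "\<Delta> - {F} \<noteq> {}"
  proof
    assume "\<Delta> - {F} = {}"
    with F have "\<Delta> = {F}"
      by blast
    then have "is_leaf \<Delta> F"
      unfolding is_leaf_def by blast
    with no_leaf show False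
      by blast
  qed
  then have "card (\<Delta> - {F}) \<noteq> 0"
    using fin by simp
  moreover have "card (\<Delta> - {F}) \<noteq> 1"
  proof
    assume "card (\<Delta> - {F}) = 1"
    then obtain G where "\<Delta> - {F} = {G}"
      by (auto simp: card_1_singleton_iff)
    then have "G \<in> \<Delta>" "F \<noteq> G" "\<Delta> - {G} = {F}"
      using F by blast+
    then have "is_leaf \<Delta> G"
      unfolding is_leaf_def by simp
    with no_leaf show False
      by blast
  qed
  ultimately have "2 \<le> card (\<Delta> - {F})"
    by linarith
  moreover have "\<forall>\<Gamma>\<subseteq>\<Delta> - {F}. \<Gamma> \<noteq> {} \<longrightarrow> (\<exists>A. is_leaf \<Gamma> A)"
  proof (intro allI impI)
    fix \<Gamma>
    assume "\<Gamma> \<subseteq> \<Delta> - {F}" "\<Gamma> \<noteq> {}"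
    then have "\<Gamma> \<subset> \<Delta>" "\<Gamma> \<noteq> {}"
      using F by blast+
    then show "\<exists>A. is_leaf \<Gamma> A"
      using cyc by (simp add: simplicial_cycle_def)
  qed
  ultimately obtain G H where "G \<noteq> H" "is_leaf (\<Delta> - {F}) G" "is_leaf (\<Delta> - {F}) H"
    using two_leaves_if_forest[of "\<Delta> - {F}"] fin by auto
  then show ?thesis
    using strong_neighbors_if_new_leaf F no_leaf by metis
qed

lemma simplicial_cycle_strong_ring:
  assumes cyc: "simplicial_cycle \<Delta>" and fin: "finite \<Delta>"
  obtains fs where "strong_ring \<Delta> fs" "set fs = \<Delta>"
proof -
  define path where
    "path ps \<longleftrightarrow> distinct ps \<and> set ps \<subseteq> \<Delta> \<and> ps \<noteq> [] \<and> successively (strong_neighbors \<Delta>) ps"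
    for ps
  obtain F0 where "F0 \<in> \<Delta>"
    using cyc by (auto simp: simplicial_cycle_def)
  then have "path [F0]"
    by (simp add: path_def)
  moreover have "\<forall>ps. path ps \<longrightarrow> length ps < Suc (card \<Delta>)"
  proof (intro allI impI)
    fix ps
    assume "path ps"
    then have "length ps = card (set ps)" "set ps \<subseteq> \<Delta>"
      by (auto simp: path_def distinct_card)
    then show "length ps < Suc (card \<Delta>)"
      using card_mono[OF fin, of "set ps"] by simp
  qed
  ultimately obtain ps where ps: "path ps" and longest: "\<And>qs. path qs \<Longrightarrow> length qs \<le> length ps"
    using ex_has_greatest_nat[of path "[F0]" length "Suc (card \<Delta>)"] by blast
  then obtain F rs where ps_eq: "ps = F # rs"
    by (cases ps) (auto simp: path_def)
  have succ: "strong_neighbors \<Delta> (ps ! i) (ps ! Suc i)" if "Suc i < length ps" for i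
    using ps that by (simp add: path_def successively_conv_nth)
  have F: "F \<in> \<Delta>"
    using ps ps_eq by (auto simp: path_def)
  \<comment> \<open>Otherwise \<open>G\<close> could be put in front of the longest path.\<close>
  have in_path: "\<exists>k. 0 < k \<and> k < length ps \<and> ps ! k = G" if G: "strong_neighbors \<Delta> F G" for G
  proof -
    have "G \<in> set ps"
    proof (rule ccontr)
      assume "G \<notin> set ps"
      then have "path (G # ps)"
        using ps G ps_eq strong_neighbors_sym[OF G]
        by (auto simp: path_def strong_neighbors_def)
      then show False
        using longest[of "G # ps"] by simp
    qed
    then obtain k where "k < length ps" "ps ! k = G"
      by (auto simp: in_set_conv_nth)
    moreover have "G \<noteq> F"
      using G by (auto simp: strong_neighbors_def)
    moreover have "k \<noteq> 0"
      using calculation ps_eq by (metis nth_Cons_0)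
    ultimately show ?thesis
      by blast
  qed
  obtain G H where "G \<noteq> H" "strong_neighbors \<Delta> F G" "strong_neighbors \<Delta> F H"
    using simplicial_cycle_two_strong_neighbors[OF cyc fin F] by blast
  then obtain k l where kl: "0 < k" "k < length ps" "0 < l" "l < length ps" "k \<noteq> l"
    "strong_neighbors \<Delta> F (ps ! k)" "strong_neighbors \<Delta> F (ps ! l)"
    by (metis in_path)
  \<comment> \<open>The larger of two distinct positive positions is at least 2, so the path up to
    position \<open>m\<close> closes to a ring of at least three facets.\<close>
  obtain m where m: "2 \<le> m" "m < length ps" "strong_neighbors \<Delta> F (ps ! m)"
    using kl by (cases "k < l") (auto intro: that[of l] that[of k])
  define fs where "fs = take (Suc m) ps"
  have len: "length fs = Suc m"
    using m by (simp add: fs_def)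
  have "strong_neighbors \<Delta> (fs ! i) (fs ! (Suc i mod length fs))" if "i < length fs" for i
  proof (cases "i = m")
    case True
    then show ?thesis
      using m ps_eq by (simp add: len strong_neighbors_sym) (simp add: fs_def strong_neighbors_sym)
  next
    case False
    then have "i < m"
      using that len by simp
    then show ?thesis
      using m succ[of i] by (simp add: len) (simp add: fs_def)
  qed
  then have ring: "strong_ring \<Delta> fs"
    using m ps by (auto simp: strong_ring_def len) (auto simp: fs_def path_def)
  have sub: "set fs \<subseteq> \<Delta>"
    using ps set_take_subset[of "Suc m" ps] by (auto simp: path_def fs_def)
  \<comment> \<open>In the smaller complex there are fewer third facets that could contain the
    intersection.\<close>
  have "strong_neighbors (set fs) (fs ! i) (fs ! (Suc i mod length fs))" if "i < length fs" for i
    by (rule strong_neighbors_subset[OF _ sub])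
       (use ring that in \<open>auto simp: strong_ring_def intro!: nth_mem mod_less_divisor\<close>)
  then have "strong_ring (set fs) fs"
    using ring by (simp add: strong_ring_def)
  then have "set fs = \<Delta>"
    using simplicial_cycle_subset_eq[OF cyc sub] strong_ring_no_leaf len by fastforce
  with ring show thesis
    by (rule that)
qed

lemma strong_ring_private_vertex:
  assumes cyc: "simplicial_cycle \<Delta>" and ring: "strong_ring \<Delta> fs" and set: "set fs = \<Delta>"
  shows "\<exists>x. x \<in> fs ! 0 \<and> x \<in> fs ! (length fs - 1) \<and>
             (\<forall>l. 0 < l \<and> l < length fs - 1 \<longrightarrow> x \<notin> fs ! l)"
proof -
  let ?n = "length fs"
  have dist: "distinct fs" and n: "3 \<le> ?n"
    and strong: "\<And>i. i < ?n \<Longrightarrow> strong_neighbors \<Delta> (fs ! i) (fs ! (Suc i mod ?n))"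
    using ring by (auto simp: strong_ring_def)
  have "strong_neighbors \<Delta> (fs ! (?n - 1)) (fs ! 0)"
    using strong[of "?n - 1"] n by (cases ?n) auto
  moreover have "fs ! 1 \<noteq> fs ! (?n - 1)" "fs ! 1 \<noteq> fs ! 0" "fs ! 1 \<in> \<Delta>"
    using dist n set by (subst nth_eq_iff_index_eq | force)+
  \<comment> \<open>Strongness of the closing pair is tested against \<open>fs ! 1\<close> only.
    This makes the index \<open>b\<close> below at least 2, so that the shortened ring still has
    three facets.\<close>
  ultimately have "\<not> fs ! (?n - 1) \<inter> fs ! 0 \<subseteq> fs ! 1"
    unfolding strong_neighbors_def by simp
  then obtain x where x: "x \<in> fs ! (?n - 1)" "x \<in> fs ! 0" "x \<notin> fs ! 1"
    by blast
  \<comment> \<open>The facets 0 to b, where b is the next index whose facet contains x, already form a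
    leafless ring, so they exhaust the cycle.\<close>
  define b where "b = (LEAST b. 0 < b \<and> x \<in> fs ! b)"
  have b: "0 < b \<and> x \<in> fs ! b"
    unfolding b_def by (rule LeastI[of _ "?n - 1"]) (use x n in auto)
  have below: "x \<notin> fs ! l" if "0 < l" "l < b" for l
    using not_less_Least[of l "\<lambda>b. 0 < b \<and> x \<in> fs ! b"] that by (auto simp: b_def)
  have bn: "b \<le> ?n - 1"
    unfolding b_def by (rule Least_le) (use x n in auto)
  have "b \<noteq> 1"
    using b x by auto
  with b have b2: "2 \<le> b"
    by simp
  define gs where "gs = take (Suc b) fs"
  have len: "length gs = Suc b"
    using bn n by (simp add: gs_def)
  have nth: "gs ! i = fs ! i" if "i \<le> b" for i
    using that by (simp add: gs_def)
  have sub: "set gs \<subseteq> \<Delta>"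
    using set set_take_subset[of "Suc b" fs] by (auto simp: gs_def)
  have dist_gs: "distinct gs"
    using dist by (simp add: gs_def)
  have "strong_neighbors (set gs) (gs ! i) (gs ! (Suc i mod length gs))" if "i < length gs" for i
  proof (cases "i = b")
    case False
    then have "i < b"
      using that len by simp
    then have "strong_neighbors \<Delta> (gs ! i) (gs ! Suc i)"
      using strong[of i] bn n by (simp add: nth)
    then show ?thesis
      using strong_neighbors_subset[OF _ sub] \<open>i < b\<close> len by simp
  next
    case True
    \<comment> \<open>The shared vertex x makes the two ends of the shorter sequence strong neighbors.\<close>
    have "strong_neighbors (set gs) (gs ! b) (gs ! 0)"
      unfolding strong_neighbors_def
    proof (intro conjI ballI)
      show "gs ! b \<in> set gs" "gs ! 0 \<in> set gs" "gs ! b \<noteq> gs ! 0"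
        using len b2 dist_gs by (auto simp: nth_eq_iff_index_eq)
      fix H
      assume "H \<in> set gs - {gs ! b, gs ! 0}"
      then obtain l where "l < Suc b" "H = gs ! l" "l \<noteq> b" "l \<noteq> 0"
        by (metis DiffE in_set_conv_nth insertCI len)
      then have "x \<notin> H"
        using below[of l] nth[of l] by simp
      moreover have "x \<in> gs ! b \<inter> gs ! 0"
        using b x nth by simp
      ultimately show "\<not> gs ! b \<inter> gs ! 0 \<subseteq> H"
        by blast
    qed
    with True show ?thesis
      by (simp add: len)
  qed
  then have "strong_ring (set gs) gs"
    using dist_gs len b2 by (simp add: strong_ring_def)
  then have "set gs = \<Delta>"
    using simplicial_cycle_subset_eq[OF cyc sub] strong_ring_no_leaf len by fastforce
  then have "length gs = ?n"
    using set dist dist_gs distinct_card by metis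
  then have "b = ?n - 1"
    using len by simp
  with x below show ?thesis
    by blast
qed

section \<open>Odd hyper-cycles and odd-cycle-freeness\<close>

text \<open>By \<open>thin\<close>, an edge contains no vertex of the hyper-cycle besides the two
  assigned to it. The condition on indices replaces the cardinality bound in every violation of
  balancedness below.\<close>

lemma not_balanced_if_thin_odd_hyper_cycle:
  assumes hc: "hyper_cycle \<Delta> xs Fs" and odd: "odd (length Fs)"
    and thin: "\<And>i j. i < length Fs \<Longrightarrow> j < length Fs \<Longrightarrow> xs ! j \<in> Fs ! i \<Longrightarrow>
                 j = i \<or> j = Suc i mod length Fs"
  shows "\<not> balanced \<Delta>"
proof
  assume "balanced \<Delta>"
  then obtain F where F: "F \<in> set Fs" "3 \<le> card (F \<inter> set xs)"
    using hc odd unfolding balanced_def by blast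
  then obtain i where i: "i < length Fs" "F = Fs ! i"
    by (auto simp: in_set_conv_nth)
  have len: "length xs = length Fs"
    using hc by (simp add: hyper_cycle_def)
  have "F \<inter> set xs \<subseteq> {xs ! i, xs ! (Suc i mod length Fs)}"
    using thin[OF i(1)] i(2) len by (fastforce simp: in_set_conv_nth)
  then have "card (F \<inter> set xs) \<le> card {xs ! i, xs ! (Suc i mod length Fs)}"
    by (intro card_mono) auto
  also have "\<dots> \<le> 2"
    by (simp add: card_insert_if)
  finally show False
    using F(2) by simp
qed

lemma balanced_imp_odd_cycle_free:
  assumes fin: "finite \<Delta>" and bal: "balanced \<Delta>"
  shows "odd_cycle_free \<Delta>"
  unfolding odd_cycle_free_def
proof
  assume "\<exists>\<Gamma>\<subseteq>\<Delta>. simplicial_cycle \<Gamma> \<and> odd (card \<Gamma>)"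
  then obtain \<Gamma> where \<Gamma>: "\<Gamma> \<subseteq> \<Delta>" "simplicial_cycle \<Gamma>" "odd (card \<Gamma>)"
    by blast
  obtain fs where ring: "strong_ring \<Gamma> fs" and set: "set fs = \<Gamma>"
    using simplicial_cycle_strong_ring[OF \<Gamma>(2)] finite_subset[OF \<Gamma>(1) fin] by blast
  define n where "n = length fs"
  have dist: "distinct fs" and n: "3 \<le> n"
    using ring by (auto simp: strong_ring_def n_def)
  \<comment> \<open>The vertex for \<open>i\<close> is shared by \<open>fs ! i\<close> and its
    predecessor, in agreement with the indexing of \<open>hyper_cycle\<close>, where facet
    \<open>i\<close> holds vertices \<open>i\<close> and \<open>i + 1\<close>.\<close>
  have "\<exists>x. x \<in> fs ! i \<and> x \<in> fs ! ((i + n - 1) mod n) \<and>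
            (\<forall>j<n. x \<in> fs ! j \<longrightarrow> i = j \<or> i = Suc j mod n)" if i: "i < n" for i
  proof -
    have rot: "rotate i fs ! l = fs ! ((i + l) mod n)" if "l < n" for l
      using that by (simp add: nth_rotate n_def)
    obtain x where x: "x \<in> rotate i fs ! 0" "x \<in> rotate i fs ! (n - 1)"
      "\<And>l. 0 < l \<Longrightarrow> l < n - 1 \<Longrightarrow> x \<notin> rotate i fs ! l"
      using strong_ring_private_vertex[OF \<Gamma>(2) strong_ring_rotate[OF ring, of i]] set
      by (auto simp: n_def)
    have "i = j \<or> i = Suc j mod n" if j: "j < n" "x \<in> fs ! j" for j
    proof -
      \<comment> \<open>This is \<open>j - i\<close> modulo \<open>n\<close>, the position of
        \<open>fs ! j\<close> in the list rotated by \<open>i\<close>.\<close>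
      define l where "l = (if i \<le> j then j - i else j + n - i)"
      have l: "l < n" "(i + l) mod n = j"
        using i j by (auto simp: l_def)
      then have "l = 0 \<or> l = n - 1"
        using x(3)[of l] rot[of l] j(2) by force
      then show ?thesis
        using i j n by (auto simp: l_def mod_Suc split: if_splits)
    qed
    moreover have "x \<in> fs ! i" "x \<in> fs ! ((i + n - 1) mod n)"
      using x(1,2) rot[of 0] rot[of "n - 1"] i n by auto
    ultimately show ?thesis
      by blast
  qed
  then obtain v where v: "\<And>i. i < n \<Longrightarrow> v i \<in> fs ! i"
    "\<And>i. i < n \<Longrightarrow> v i \<in> fs ! ((i + n - 1) mod n)"
    "\<And>i j. i < n \<Longrightarrow> j < n \<Longrightarrow> v i \<in> fs ! j \<Longrightarrow> i = j \<or> i = Suc j mod n"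
    by metis
  define xs where "xs = map v [0..<n]"
  \<comment> \<open>Equal vertices at distinct indices would make each index the successor of the
    other, impossible for \<open>n \<ge> 3\<close>.\<close>
  have inj: "inj_on v {..<n}"
  proof (rule inj_onI)
    fix i j
    assume ij: "i \<in> {..<n}" "j \<in> {..<n}" "v i = v j"
    then have "i = j \<or> i = Suc j mod n" "j = i \<or> j = Suc i mod n"
      using v(1)[of i] v(1)[of j] v(3)[of i j] v(3)[of j i] by auto
    then show "i = j"
      using ij n by (auto simp: mod_Suc split: if_splits)
  qed
  have "v (Suc i mod n) \<in> fs ! i" if "i < n" for i
  proof -
    have "(Suc i mod n + n - 1) mod n = i"
      using that by (cases "Suc i = n") auto
    then show ?thesis
      using v(2)[of "Suc i mod n"] that by simp
  qed
  then have "hyper_cycle \<Delta> xs fs"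
    using v(1) inj n dist set \<Gamma>(1)
    by (auto simp: hyper_cycle_def xs_def distinct_map lessThan_atLeast0 n_def[symmetric])
  moreover have "odd (length fs)"
    using \<Gamma>(3) set dist distinct_card by metis
  ultimately have "\<not> balanced \<Delta>"
    by (rule not_balanced_if_thin_odd_hyper_cycle)
       (use v(3) in \<open>auto simp: n_def[symmetric] xs_def\<close>)
  with bal show False by contradiction
qed

section \<open>The complement of the 7-cycle in the line graph\<close>

text \<open>Without a common vertex, points chosen from the three pairwise intersections each miss
  the third facet. They are therefore distinct and form a thin hyper-cycle of length 3.\<close>

lemma balanced_three_Helly:
  assumes bal: "balanced \<Delta>" and mem: "{A, B, C} \<subseteq> \<Delta>" and dist: "distinct [A, B, C]"
    and ne: "A \<inter> B \<noteq> {}" "B \<inter> C \<noteq> {}" "C \<inter> A \<noteq> {}"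
  shows "A \<inter> B \<inter> C \<noteq> {}"
proof
  assume empty: "A \<inter> B \<inter> C = {}"
  obtain x y z where "x \<in> C \<inter> A" "y \<in> A \<inter> B" "z \<in> B \<inter> C"
    using ne by blast
  then have xyz: "x \<in> C" "x \<in> A" "y \<in> A" "y \<in> B" "z \<in> B" "z \<in> C" "x \<notin> B" "y \<notin> C" "z \<notin> A"
    using empty by blast+
  have "hyper_cycle \<Delta> [x, y, z] [A, B, C]"
    using xyz mem dist by (auto simp: hyper_cycle_def less_Suc_eq)
  then have "\<not> balanced \<Delta>"
    by (rule not_balanced_if_thin_odd_hyper_cycle)
       (use xyz in \<open>auto simp: less_Suc_eq\<close>)
  with bal show False by contradiction
qed

lemma has_induced_copyE:
  assumes "has_induced_copy G K"
  obtains g where "inj_on g (pverts K)" "g ` pverts K \<subseteq> pverts G"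
    "\<And>u v. u \<in> pverts K \<Longrightarrow> v \<in> pverts K \<Longrightarrow> (g u, g v) \<in> parcs G \<longleftrightarrow> (u, v) \<in> parcs K"
proof -
  obtain H where H: "induced_subgraph (with_proj H) (with_proj G)"
      "digraph_iso (with_proj H) (with_proj K)"
    using assms by (auto simp: has_induced_copy_def)
  then obtain f where f: "pre_digraph.digraph_isomorphism (with_proj H) f"
      "with_proj K = app_iso f (with_proj H)"
    by (auto simp: digraph_iso_def)
  let ?f = "iso_verts f"
  have inj: "inj_on ?f (pverts H)"
    using pre_digraph.digraph_isomorphism_inj_on_verts[OF f(1)] by simp
  have vK: "pverts K = ?f ` pverts H"
    using arg_cong[OF f(2), of verts] by simp
  have wf: "wf_digraph (with_proj H)"
    using H(1) by (simp add: induced_subgraph_def subgraph_def)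
  \<comment> \<open>An isomorphism has its own map on arcs. Comparing \<open>arcs_ends\<close>
    eliminates it, since an arc of a pair digraph is its own pair of ends.\<close>
  have aK: "parcs K = (\<lambda>(u, v). (?f u, ?f v)) ` parcs H"
    using arg_cong[OF f(2), of arcs_ends] wf_digraph.arcs_ends_app_iso_eq[OF wf f(1)] by simp
  have vH: "pverts H \<subseteq> pverts G"
    and aH: "parcs H = {e \<in> parcs G. fst e \<in> pverts H \<and> snd e \<in> pverts H}"
    using H(1) by (auto simp: induced_subgraph_def subgraph_def)
  \<comment> \<open>The isomorphism leads from the subgraph \<open>H\<close> to \<open>K\<close>;
    the embedding needs the opposite direction.\<close>
  let ?g = "the_inv_into (pverts H) ?f"
  have gf: "?g (?f u) = u" if "u \<in> pverts H" for u
    using the_inv_into_f_f[OF inj that] .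
  show thesis
  proof (rule that[of ?g])
    show "inj_on ?g (pverts K)"
      using inj by (simp add: vK inj_on_the_inv_into)
    show "?g ` pverts K \<subseteq> pverts G"
      using vH by (auto simp: vK gf)
    fix u v
    assume "u \<in> pverts K" "v \<in> pverts K"
    then obtain a b where ab: "u = ?f a" "a \<in> pverts H" "v = ?f b" "b \<in> pverts H"
      by (auto simp: vK)
    have "(?f a, ?f b) \<in> parcs K \<longleftrightarrow> (\<exists>(c, d)\<in>parcs H. ?f a = ?f c \<and> ?f b = ?f d)"
      by (force simp: aK)
    also have "\<dots> \<longleftrightarrow> (\<exists>(c, d)\<in>parcs H. a = c \<and> b = d)"
      using ab inj by (intro bex_cong) (auto simp: aH inj_on_eq_iff)
    also have "\<dots> \<longleftrightarrow> (a, b) \<in> parcs H"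
      by auto
    also have "\<dots> \<longleftrightarrow> (a, b) \<in> parcs G"
      using ab by (simp add: aH)
    finally show "(?g u, ?g v) \<in> parcs G \<longleftrightarrow> (u, v) \<in> parcs K"
      using ab by (simp add: gf)
  qed
qed

lemma balanced_imp_no_co_C7:
  assumes bal: "balanced \<Delta>"
  shows "\<not> has_induced_copy (line_graph \<Delta>) (graph_complement (cycle_graph 7))"
proof
  let ?K = "graph_complement (cycle_graph 7)"
  assume "has_induced_copy (line_graph \<Delta>) ?K"
  then obtain g where inj: "inj_on g (pverts ?K)" and sub: "g ` pverts ?K \<subseteq> \<Delta>"
    and arcs: "\<And>u v. u \<in> pverts ?K \<Longrightarrow> v \<in> pverts ?K \<Longrightarrow>
                 (g u, g v) \<in> parcs (line_graph \<Delta>) \<longleftrightarrow> (u, v) \<in> parcs ?K"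
    by (rule has_induced_copyE) (simp add: line_graph_def)
  have K: "pverts ?K = {..<7}"
    by (simp add: graph_complement_def cycle_graph_def)
  have meet: "g u \<inter> g v \<noteq> {} \<longleftrightarrow> v \<noteq> Suc u mod 7 \<and> u \<noteq> Suc v mod 7"
    if "u < 7" "v < 7" "u \<noteq> v" for u v
  proof -
    have "g u \<noteq> g v"
      using inj that by (auto simp: K dest: inj_onD)
    then show ?thesis
      using arcs[of u v] sub that
      by (auto simp: K line_graph_def graph_complement_def cycle_graph_def)
  qed
  \<comment> \<open>Along \<open>F k = g (2 k mod 7)\<close> the intersecting pairs are those at cyclic distance 1 or 2.\<close>
  define F where "F k = g (2 * k mod 7)" for k
  \<comment> \<open>Turns the claims about residues modulo 7 into finite case distinctions that
    \<open>simp\<close> computes.\<close>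
  have less7: "k < 7 \<longleftrightarrow> k \<in> {0, 1, 2, 3, 4, 5, 6}" for k :: nat
    by auto
  have F_mem: "F k \<in> \<Delta>" for k
    using sub by (auto simp: F_def K)
  have F_inj: "F k \<noteq> F l" if "k < 7" "l < 7" "k \<noteq> l" for k l
  proof -
    have "2 * k mod 7 \<noteq> 2 * l mod 7"
      using that unfolding less7 by (elim insertE emptyE) simp_all
    then show ?thesis
      using inj by (auto simp: F_def K dest: inj_onD)
  qed
  \<comment> \<open>The term \<open>(l + 7 - k) mod 7\<close> is the cyclic difference, free of
    truncated subtraction. Disjointness means \<open>2 * (l - k)\<close> is 1 or -1 modulo 7, that
    is, a difference of 3 or 4.\<close>
  have F_meet: "F k \<inter> F l \<noteq> {} \<longleftrightarrow> (l + 7 - k) mod 7 \<in> {1, 2, 5, 6}"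
    if "k < 7" "l < 7" "k \<noteq> l" for k l
  proof -
    have "2 * k mod 7 \<noteq> 2 * l mod 7"
      using that unfolding less7 by (elim insertE emptyE) simp_all
    then have "F k \<inter> F l \<noteq> {} \<longleftrightarrow>
        2 * l mod 7 \<noteq> Suc (2 * k mod 7) mod 7 \<and> 2 * k mod 7 \<noteq> Suc (2 * l mod 7) mod 7"
      unfolding F_def by (intro meet) auto
    then show ?thesis
      using that unfolding less7 by (elim insertE emptyE) simp_all
  qed
  have "\<exists>y. \<forall>l<7. y \<in> F l \<longleftrightarrow> (l + 7 - k) mod 7 \<in> {0, 1, 2}" if "k < 7" for k
  proof -
    let ?a = "(k + 1) mod 7" and ?b = "(k + 2) mod 7"
    have "F k \<inter> F ?a \<inter> F ?b \<noteq> {}"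
    proof (rule balanced_three_Helly[OF bal])
      show "distinct [F k, F ?a, F ?b]"
        using F_inj[of k ?a] F_inj[of k ?b] F_inj[of ?a ?b] that unfolding less7 by (elim insertE emptyE) simp_all
      have "F k \<inter> F ?a \<noteq> {} \<and> F ?a \<inter> F ?b \<noteq> {} \<and> F ?b \<inter> F k \<noteq> {}"
        using F_meet[of k ?a] F_meet[of ?a ?b] F_meet[of ?b k] that
        unfolding less7 by (elim insertE emptyE) simp_all
      then show "F k \<inter> F ?a \<noteq> {}" "F ?a \<inter> F ?b \<noteq> {}" "F ?b \<inter> F k \<noteq> {}"
        by blast+
    qed (use F_mem in auto)
    then obtain y where y: "y \<in> F k" "y \<in> F ?a" "y \<in> F ?b"
      by blast
    have "y \<in> F l \<longleftrightarrow> (l + 7 - k) mod 7 \<in> {0, 1, 2}" if l: "l < 7" for l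
    proof
      assume yl: "y \<in> F l"
      \<comment> \<open>A facet through \<open>y\<close> meets all three chosen facets, so its index
        is at difference 3 or 4 from none of \<open>k\<close>, \<open>k + 1\<close>,
        \<open>k + 2\<close>. Only these three indices remain.\<close>
      have "(l + 7 - m) mod 7 \<in> {0, 1, 2, 5, 6}" if "m < 7" "y \<in> F m" for m
        using F_meet[of m l] that l yl by (cases "m = l") auto
      from this[of k] this[of ?a] this[of ?b] show "(l + 7 - k) mod 7 \<in> {0, 1, 2}"
        using y \<open>k < 7\<close> l unfolding less7 by (elim insertE emptyE) simp_all
    next
      assume "(l + 7 - k) mod 7 \<in> {0, 1, 2}"
      then have "l = k \<or> l = ?a \<or> l = ?b"
        using \<open>k < 7\<close> l unfolding less7 by (elim insertE emptyE) simp_all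
      with y show "y \<in> F l"
        by blast
    qed
    then show ?thesis
      by blast
  qed
  then obtain y where y: "\<And>k l. k < 7 \<Longrightarrow> l < 7 \<Longrightarrow> y k \<in> F l \<longleftrightarrow> (l + 7 - k) mod 7 \<in> {0, 1, 2}"
    by metis
  have y_inj: "y k \<noteq> y l" if "k < 7" "l < 7" "k \<noteq> l" for k l
  proof
    assume eq: "y k = y l"
    \<comment> \<open>A difference and its negative modulo 7 lie both in \<open>{0, 1, 2}\<close>
      only if they are 0.\<close>
    have "(k + 7 - l) mod 7 \<in> {0, 1, 2}" "(l + 7 - k) mod 7 \<in> {0, 1, 2::nat}"
      using y[of k k] y[of l k] y[of l l] y[of k l] that eq by auto
    then show False
      using that unfolding less7 by (elim insertE emptyE) simp_all
  qed
  \<comment> \<open>Of all the \<open>y k\<close>, facet \<open>F l\<close> contains exactly those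
    with \<open>k\<close> equal to \<open>l - 2\<close>, \<open>l - 1\<close> or \<open>l\<close>
    modulo 7. Dropping \<open>y 1\<close> and \<open>y 5\<close> leaves two in each listed facet;
    \<open>F 4\<close> still has \<open>y 2\<close>, \<open>y 3\<close>, \<open>y 4\<close> and is
    avoided.\<close>
  have "hyper_cycle \<Delta> [y 0, y 2, y 3, y 4, y 6] [F 2, F 3, F 5, F 6, F 0]"
    using F_mem by (auto simp: hyper_cycle_def y y_inj F_inj less_Suc_eq)
  then have "\<not> balanced \<Delta>"
    by (rule not_balanced_if_thin_odd_hyper_cycle)
       (auto simp: y less_Suc_eq)
  with bal show False by contradiction
qed

theorem proposition5p4:
  fixes V :: "'a set" and \<Delta> :: "'a set set"
  assumes "facet_complex V \<Delta>"
    and "balanced \<Delta>"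
  shows "odd_cycle_free \<Delta> \<and>
         \<not> has_induced_copy (line_graph \<Delta>) (graph_complement (cycle_graph 7))"
proof -
  have "finite \<Delta>"
    using assms(1) finite_subset[of \<Delta> "Pow V"] by (auto simp: facet_complex_def)
  with assms(2) show ?thesis
    by (simp add: balanced_imp_odd_cycle_free balanced_imp_no_co_C7)
qed

end
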